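(* Let $n\geq 2$ be an integer, let $\alpha=2^n+1$, and put $m=(\alpha+1)^2(\alpha-1)$ and $r=\alpha^2-1$. Then there does not exist an $(m^2,\ r(m+1),\ -m+r^2+3r,\ r^2+r)$-partial difference set in any abelian group $G$.
   Context: Let $G$ be a finite group of order $v$ and let $D\subseteq G$ be a subset of size $k$. $D$ is a $(v,k,\lambda,\mu)$-partial difference set (PDS) in $G$ if the expressions $gh^{-1}$, with $g,h\in D$ and $g\neq h$, represent each non-identity element of $D$ exactly $\lambda$ times and each non-identity element of $G$ not in $D$ exactly $\mu$ times. *)

theory Defs
  imports "HOL-Algebra.Coset"
begin

(* The number of ways to write x as g h^{-1} with (g,h) an ordered pair of distinct elements of D. *)
definition diff_reps :: "('a, 'b) monoid_scheme \<Rightarrow> 'a set \<Rightarrow> 'a \<Rightarrow> nat" where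
  "diff_reps G D x =
     card {(g, h). g \<in> D \<and> h \<in> D \<and> g \<noteq> h \<and> g \<otimes>\<^bsub>G\<^esub> inv\<^bsub>G\<^esub> h = x}"

(* The parameters are integers so that expressions such as -m + r^2 + 3r carry no truncated
   subtraction. Neither \<one> \<notin> D nor closure of D under inverses (regularity) is required. *)
definition partial_difference_set ::
  "('a, 'b) monoid_scheme \<Rightarrow> 'a set \<Rightarrow> int \<Rightarrow> int \<Rightarrow> int \<Rightarrow> int \<Rightarrow> bool" where
  "partial_difference_set G D v k l u \<longleftrightarrow>
     group G \<and> finite (carrier G) \<and> int (order G) = v \<and>
     D \<subseteq> carrier G \<and> int (card D) = k \<and>
     (\<forall>x \<in> D - {\<one>\<^bsub>G\<^esub>}. int (diff_reps G D x) = l) \<and>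
     (\<forall>x \<in> carrier G - D - {\<one>\<^bsub>G\<^esub>}. int (diff_reps G D x) = u)"

end

theory Submission
  imports Defs "HOL-Algebra.Sylow" "HOL-Algebra.Multiplicative_Group"
    "HOL-Library.Poly_Mapping" "HOL-Library.Function_Algebras"
    "HOL-Computational_Algebra.Primes"
begin

text \<open>
  Put \<open>t = 2 ^ (n - 1)\<close> and \<open>s = t + 1\<close>. Then \<open>m = 8 t s\<^sup>2\<close>, \<open>r = 4 t s\<close>, and the group has order
  \<open>m\<^sup>2 = (64 t\<^sup>2) s\<^sup>4\<close>, where \<open>t\<close> is even because \<open>n \<ge> 2\<close>. Hence \<open>s\<close> is odd and the
  two factors \<open>q = 64 t\<^sup>2\<close> and \<open>w = s\<^sup>4\<close> are coprime.

  In the integral group ring a partial difference set \<open>D\<close> with these parameters is symmetric, does not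
  contain \<open>\<one>\<close>, and satisfies \<open>(D - r)(D - r + m) = \<mu> G\<close> with \<open>\<mu> = r\<^sup>2 + r\<close>. The power map
  \<open>x \<mapsto> x\<^sup>w\<close> is a homomorphism onto a group \<open>I\<close> of order \<open>q\<close> with all fibres of size \<open>w\<close>, so the image \<open>a\<close>
  of \<open>D - r\<close> in the group ring of \<open>I\<close> satisfies \<open>a\<^sup>2 = - m a + \<mu> w I\<close>
  (\<open>shifted_projection_convolution\<close>).

  The arithmetic heart is that \<open>s\<^sup>2\<close> divides every coefficient of \<open>a\<close>. A prime \<open>p\<close> dividing \<open>s\<close> does
  not divide the order of \<open>I\<close>, so the group ring of \<open>I\<close> modulo \<open>p\<close> is reduced: if \<open>b\<^sup>2\<close> vanishes modulo \<open>p\<close>,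
  then so does \<open>b\<^sup>p\<close>, which by the Frobenius identity is the sum of the \<open>b\<^sub>x\<^sup>p x\<^sup>p\<close>, and the
  elements \<open>x\<^sup>p\<close> are distinct (\<open>prime_dvd_convolution_square\<close>). As \<open>s\<^sup>2\<close> divides \<open>m\<close> and \<open>s\<^sup>4\<close>
  divides \<open>\<mu> w\<close>, the prime factors of \<open>s\<^sup>2\<close> can be cleared from the equation one after the other
  (\<open>dvd_of_convolution_eq\<close>).

  Now write \<open>a = s\<^sup>2 c\<close> and \<open>z = s - 2 c\<close>; all values of \<open>z\<close> are odd. The total of \<open>a\<close> and the
  coefficient of \<open>a\<^sup>2\<close> at \<open>\<one>\<close>, a sum of squares by the symmetry of \<open>D\<close>, combine to \<open>\<Sum> z\<^sub>x\<^sup>2 = 16 t z\<^sub>1\<close>, the sum running over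
  \<open>64 t\<^sup>2\<close> elements. Since every square is at least \<open>1\<close>, this forces \<open>z\<^sub>1 \<ge> 8 t - 1\<close>
  (\<open>odd_square_sum_bound\<close>), so \<open>c\<^sub>1\<close> is very negative. But \<open>s\<^sup>2 c\<^sub>1 + r\<close> counts the elements of \<open>D\<close> in the kernel
  of the power map, and the bound makes this number negative.
\<close>

section \<open>The Frobenius identity modulo a prime\<close>

text \<open>
  In this form the identity applies to rings of characteristic zero, with the prime chosen freely;
  the group ring below has integer coefficients and is only read modulo \<open>p\<close>.
\<close>

lemma freshmans_dream_dvd:
  fixes x y :: "'a :: comm_ring_1"
  assumes "prime p"
  shows "of_nat p dvd (x + y) ^ p - (x ^ p + y ^ p)"
proof -
  have p: "0 < p" using assms by (simp add: prime_gt_0_nat)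
  define t where "t k = of_nat (p choose k) * x ^ k * y ^ (p - k)" for k
  have "(x + y) ^ p = sum t {..p}" unfolding t_def by (rule binomial_ring)
  also have "{..p} = insert 0 (insert p {1..<p})" using p by auto
  also have "sum t \<dots> = x ^ p + y ^ p + sum t {1..<p}"
    using p by (simp add: t_def)
  finally have "(x + y) ^ p - (x ^ p + y ^ p) = sum t {1..<p}" by simp
  moreover have "of_nat p dvd t k" if "k \<in> {1..<p}" for k
  proof -
    have "p dvd (p choose k)" by (rule dvd_choose_prime) (use that assms in auto)
    then show ?thesis by (auto simp: t_def)
  qed
  ultimately show ?thesis by (auto intro!: dvd_sum)
qed

lemma freshmans_dream_sum_dvd:
  fixes f :: "'b \<Rightarrow> 'a :: comm_ring_1"
  assumes "prime p"
  shows "of_nat p dvd (\<Sum>i\<in>A. f i) ^ p - (\<Sum>i\<in>A. f i ^ p)"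
proof (induction A rule: infinite_finite_induct)
  case (insert i A)
  have "of_nat p dvd ((f i + sum f A) ^ p - (f i ^ p + sum f A ^ p)) + (sum f A ^ p - (\<Sum>i\<in>A. f i ^ p))"
    using freshmans_dream_dvd[OF assms] insert.IH by (intro dvd_add)
  with insert.hyps show ?case by (simp add: algebra_simps)
qed (use prime_gt_0_nat[OF assms] in \<open>auto simp: power_0_left\<close>)

section \<open>The group ring of a finite abelian group modulo a prime\<close>

text \<open>
  The group ring of a group with a carrier set is presented as a quotient of a ring that exists as
  a type: polynomials with integer coefficients in variables indexed by the group elements. A
  monomial is its exponent function, \<open>word_value\<close> evaluates it in the group, and \<open>coeff_at F y\<close> is the
  coefficient at \<open>y\<close> of the image of \<open>F\<close> in the group ring. Commutativity, associativity and the Frobenius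
  identity are then inherited from the polynomial ring.
\<close>

context comm_group
begin

definition word_value :: "('a \<Rightarrow> nat) \<Rightarrow> 'a" where
  "word_value M = (\<Otimes>x\<in>carrier G. x [^] M x)"

lemma word_value_closed [simp]: "word_value M \<in> carrier G"
  by (auto simp: word_value_def)

lemma word_value_add: "word_value (M + N) = word_value M \<otimes> word_value N"
proof -
  have "word_value (M + N) = (\<Otimes>x\<in>carrier G. x [^] M x \<otimes> x [^] N x)"
    unfolding word_value_def by (rule finprod_cong') (auto simp: nat_pow_mult)
  then show ?thesis by (simp add: word_value_def Pi_def)
qed

lemma word_value_zero: "word_value 0 = \<one>"
proof -
  have "word_value 0 = (\<Otimes>x\<in>carrier G. \<one>)"
    unfolding word_value_def by (rule finprod_cong') auto
  then show ?thesis by simp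
qed

lemma word_value_scale: "word_value (\<lambda>z. j * M z) = word_value M [^] (j :: nat)"
proof (induction j)
  case 0
  then show ?case using word_value_zero by (simp add: zero_fun_def)
next
  case (Suc j)
  have "(\<lambda>z. Suc j * M z) = (\<lambda>z. j * M z) + M" by (auto simp: plus_fun_def)
  then show ?case by (simp add: word_value_add Suc.IH)
qed

definition letter :: "'a \<Rightarrow> 'a \<Rightarrow> nat" where
  "letter x = (\<lambda>z. if z = x then 1 else 0)"

lemma word_value_letter:
  assumes "finite (carrier G)" "x \<in> carrier G"
  shows "word_value (letter x) = x"
proof -
  have "word_value (letter x) = (\<Otimes>z\<in>carrier G. if z = x then z else \<one>)"
    unfolding word_value_def letter_def by (rule finprod_cong') auto
  also have "\<dots> = x"
    using finprod_singleton_swap[of x "carrier G" "\<lambda>z. z"] assms by (simp add: Pi_def)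
  finally show ?thesis .
qed

definition coeff_at :: "(('a \<Rightarrow> nat) \<Rightarrow>\<^sub>0 int) \<Rightarrow> 'a \<Rightarrow> int" where
  "coeff_at F y = (\<Sum>M\<in>Poly_Mapping.keys F. if word_value M = y then Poly_Mapping.lookup F M else 0)"

lemma coeff_at_superset:
  assumes "finite S" "Poly_Mapping.keys F \<subseteq> S"
  shows "coeff_at F y = (\<Sum>M\<in>S. if word_value M = y then Poly_Mapping.lookup F M else 0)"
  unfolding coeff_at_def using assms
  by (intro sum.mono_neutral_left) (auto simp: in_keys_iff)

lemma coeff_at_add: "coeff_at (F + F') y = coeff_at F y + coeff_at F' y"
proof -
  let ?S = "Poly_Mapping.keys F \<union> Poly_Mapping.keys F'"
  have "Poly_Mapping.keys (F + F') \<subseteq> ?S" by (rule keys_add)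
  then show ?thesis
    by (simp add: coeff_at_superset[of ?S] lookup_add sum.distrib[symmetric] if_distrib cong: if_cong)
qed

lemma coeff_at_zero [simp]: "coeff_at 0 y = 0"
  by (simp add: coeff_at_def)

lemma coeff_at_sum: "coeff_at (\<Sum>i\<in>A. f i) y = (\<Sum>i\<in>A. coeff_at (f i) y)"
  by (induction A rule: infinite_finite_induct) (simp_all add: coeff_at_add)

lemma coeff_at_single:
  "coeff_at (Poly_Mapping.single M c) y = (if word_value M = y then c else 0)"
  by (subst coeff_at_superset[of "{M}"]) auto

lemma sum_of_monomials:
  "F = (\<Sum>M\<in>Poly_Mapping.keys F. Poly_Mapping.single M (Poly_Mapping.lookup F M))"
  by (rule poly_mapping_eqI)
     (auto simp: lookup_sum lookup_single when_def in_keys_iff sum.delta[OF finite_keys])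

lemma coeff_at_single_mult:
  assumes "y \<in> carrier G"
  shows "coeff_at (Poly_Mapping.single M c * F) y = c * coeff_at F (inv (word_value M) \<otimes> y)"
proof -
  have *: "word_value M \<otimes> x = y \<longleftrightarrow> x = inv (word_value M) \<otimes> y" if "x \<in> carrier G" for x
    using that assms by (metis inv_solve_left word_value_closed)
  have "coeff_at (Poly_Mapping.single M c * F) y =
    (\<Sum>N\<in>Poly_Mapping.keys F. coeff_at (Poly_Mapping.single (M + N) (c * Poly_Mapping.lookup F N)) y)"
    by (subst sum_of_monomials[of F]) (simp only: sum_distrib_left coeff_at_sum mult_single)
  also have "\<dots> = (\<Sum>N\<in>Poly_Mapping.keys F. c * (if word_value N = inv (word_value M) \<otimes> y then Poly_Mapping.lookup F N else 0))"
    by (intro sum.cong refl) (simp add: coeff_at_single word_value_add *)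
  also have "\<dots> = c * coeff_at F (inv (word_value M) \<otimes> y)"
    by (simp add: coeff_at_def sum_distrib_left)
  finally show ?thesis .
qed

text \<open>
  The polynomials whose image in the group ring vanishes modulo \<open>d\<close> form an ideal. Thus
  higher powers of an element inherit the vanishing of its square.
\<close>

lemma coeff_at_dvd_mult:
  assumes "\<And>y. y \<in> carrier G \<Longrightarrow> d dvd coeff_at F y" "y \<in> carrier G"
  shows "d dvd coeff_at (E * F) y"
proof -
  have "E * F = (\<Sum>M\<in>Poly_Mapping.keys E. Poly_Mapping.single M (Poly_Mapping.lookup E M) * F)"
    by (subst sum_of_monomials[of E]) (simp only: sum_distrib_right)
  then show ?thesis
    using assms by (auto simp: coeff_at_sum coeff_at_single_mult intro!: dvd_sum)
qed

lemma single_power: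
  "Poly_Mapping.single M (c::int) ^ j = Poly_Mapping.single (\<lambda>z :: 'a. j * M z :: nat) (c ^ j)"
proof (induction j)
  case 0
  then show ?case using single_one by (simp add: zero_fun_def[symmetric])
next
  case (Suc j)
  have "(\<lambda>z. Suc j * M z) = M + (\<lambda>z. j * M z)" by (auto simp: plus_fun_def)
  then show ?case by (simp add: Suc.IH mult_single)
qed

lemma pow_coprime_inj:
  assumes "finite (carrier G)" "coprime p (order G)"
    "x \<in> carrier G" "y \<in> carrier G" "x [^] (p::nat) = y [^] p"
  shows "x = y"
proof -
  have z: "x \<otimes> inv y \<in> carrier G" using assms by simp
  have "(x \<otimes> inv y) [^] p = \<one>"
    using assms by (simp add: nat_pow_distrib nat_pow_inv)
  then have "ord (x \<otimes> inv y) dvd p" using z by (simp add: pow_eq_id)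
  moreover have "ord (x \<otimes> inv y) dvd order G" using z by (rule ord_dvd_group_order)
  ultimately have "ord (x \<otimes> inv y) = 1" using assms(2)
    by (metis coprime_common_divisor_nat)
  then have "x \<otimes> inv y = \<one>" using ord_eq_1[OF z] by simp
  then show ?thesis using assms by (metis inv_inv inv_closed inv_equality)
qed

text \<open>
  The group ring modulo a prime \<open>p\<close> that does not divide the group order has no nonzero element of
  square zero. If the square of \<open>S\<close> vanishes modulo \<open>p\<close>, then so does \<open>S ^ p\<close>, whose coefficient at \<open>x [^] p\<close> is
  \<open>a x ^ p\<close> modulo \<open>p\<close>, because no other group element has the same \<open>p\<close>-th power as \<open>x\<close>.
\<close>

lemma prime_dvd_convolution_square:
  fixes a :: "'a \<Rightarrow> int"
  assumes fin: "finite (carrier G)" and p: "prime p" and cop: "coprime p (order G)"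
    and sq: "\<And>y. y \<in> carrier G \<Longrightarrow> int p dvd (\<Sum>x\<in>carrier G. a x * a (inv x \<otimes> y))"
    and x: "x \<in> carrier G"
  shows "int p dvd a x"
proof -
  define S where "S = (\<Sum>x\<in>carrier G. Poly_Mapping.single (letter x) (a x))"
  have S_at: "coeff_at S y = a y" if "y \<in> carrier G" for y
  proof -
    have "coeff_at S y = (\<Sum>x\<in>carrier G. if x = y then a x else 0)"
      unfolding S_def coeff_at_sum
      by (intro sum.cong refl) (simp add: coeff_at_single word_value_letter fin)
    then show ?thesis using that fin by simp
  qed
  have SS: "int p dvd coeff_at (S * S) y" if "y \<in> carrier G" for y
  proof -
    have "coeff_at (S * S) y = coeff_at ((\<Sum>x\<in>carrier G. Poly_Mapping.single (letter x) (a x)) * S) y"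
      by (simp add: S_def)
    also have "\<dots> = (\<Sum>x\<in>carrier G. a x * a (inv x \<otimes> y))"
      unfolding sum_distrib_right coeff_at_sum
      by (intro sum.cong refl) (simp add: coeff_at_single_mult that word_value_letter fin S_at)
    finally show ?thesis using sq that by simp
  qed
  \<comment> \<open>the \<open>p\<close>-th power is a multiple of the square\<close>
  have "p \<ge> 2" using p by (rule prime_ge_2_nat)
  then have "S ^ p = S ^ (p - 2) * (S * S)"
    by (metis le_add_diff_inverse2 power_add power2_eq_square)
  then have Sp: "int p dvd coeff_at (S ^ p) y" if "y \<in> carrier G" for y
    using coeff_at_dvd_mult[OF SS that] by simp
  obtain E where E: "S ^ p - (\<Sum>x\<in>carrier G. Poly_Mapping.single (letter x) (a x) ^ p) = of_nat p * E"
    using freshmans_dream_sum_dvd[OF p, of "\<lambda>x. Poly_Mapping.single (letter x) (a x)" "carrier G"]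
    unfolding S_def by blast
  \<comment> \<open>compare the coefficients at \<open>x [^] p\<close> on both sides of the Frobenius identity\<close>
  let ?y = "x [^] p"
  have y: "?y \<in> carrier G" using x by simp
  have "coeff_at (of_nat p * E) ?y = coeff_at (Poly_Mapping.single 0 (int p) * E) ?y"
    by (simp add: single_of_nat)
  then have pE: "int p dvd coeff_at (of_nat p * E) ?y"
    by (metis coeff_at_single_mult[OF y] dvd_triv_left)
  have "coeff_at (\<Sum>z\<in>carrier G. Poly_Mapping.single (letter z) (a z) ^ p) ?y
      = (\<Sum>z\<in>carrier G. if z = x then a z ^ p else 0)"
    unfolding coeff_at_sum single_power coeff_at_single word_value_scale
    using pow_coprime_inj[OF fin cop] x
    by (intro sum.cong refl) (auto simp: word_value_letter fin)
  also have "\<dots> = a x ^ p" using x fin by simp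
  finally have "coeff_at (S ^ p) ?y = a x ^ p + coeff_at (of_nat p * E) ?y"
    by (simp only: E[unfolded diff_eq_eq] coeff_at_add add.commute)
  with Sp[OF y] pE have "int p dvd a x ^ p" by (simp add: dvd_add_left_iff)
  then show ?thesis using p by (meson prime_dvd_power prime_nat_int_transfer)
qed

text \<open>
  Let \<open>g\<close> be the largest divisor of \<open>d\<close> that divides all coefficients, and let \<open>p\<close> be a prime factor of
  \<open>d / g\<close>. Dividing the equation by \<open>g\<^sup>2\<close> shows that the square of \<open>a / g\<close> vanishes modulo \<open>p\<close>, so \<open>a / g\<close> is itself
  divisible by \<open>p\<close>, against the choice of \<open>g\<close>.
\<close>

lemma dvd_of_convolution_eq:
  fixes a :: "'a \<Rightarrow> int" and d :: nat
  assumes fin: "finite (carrier G)" and cop: "coprime d (order G)" and d: "d > 0"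
    and eq: "\<And>y. y \<in> carrier G \<Longrightarrow> (\<Sum>x\<in>carrier G. a x * a (inv x \<otimes> y)) = A * a y + B"
    and A: "int d dvd A" and B: "(int d)\<^sup>2 dvd B"
    and x: "x \<in> carrier G"
  shows "int d dvd a x"
proof -
  have "g = d" if g: "g dvd d" "\<And>x. x \<in> carrier G \<Longrightarrow> int g dvd a x"
      and mx: "\<And>g'. g' dvd d \<Longrightarrow> (\<And>x. x \<in> carrier G \<Longrightarrow> int g' dvd a x) \<Longrightarrow> g' \<le> g" for g
  proof (rule ccontr)
    assume "g \<noteq> d"
    obtain e where e: "d = g * e" using g(1) by blast
    have "e \<noteq> 1" "e > 0" "g > 0" using \<open>g \<noteq> d\<close> e d by auto
    then obtain p where p: "prime p" "p dvd e" using prime_factor_nat by blast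
    then obtain f where f: "e = p * f" by blast
    define b where "b x = a x div int g" for x
    have ab: "a x = int g * b x" if "x \<in> carrier G" for x using g(2)[OF that] by (simp add: b_def)
    obtain A' where A': "A = int d * A'" using A by blast
    obtain B' where B': "B = (int d)\<^sup>2 * B'" using B by blast
    have "int p dvd (\<Sum>x\<in>carrier G. b x * b (inv x \<otimes> y))" if y: "y \<in> carrier G" for y
    proof -
      have "int g * int g * (\<Sum>x\<in>carrier G. b x * b (inv x \<otimes> y))
          = (\<Sum>x\<in>carrier G. a x * a (inv x \<otimes> y))"
        unfolding sum_distrib_left using y by (intro sum.cong refl) (simp add: ab)
      also have "\<dots> = int g * int g * (int p * (int f * A' * b y + int f * int e * B'))"
        unfolding eq[OF y] A' B' ab[OF y] unfolding e f by (simp add: power2_eq_square algebra_simps)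
      finally show ?thesis using \<open>g > 0\<close> by simp
    qed
    moreover have "coprime p (order G)"
      using cop p(2) e by (meson coprime_divisors dvd_mult dvd_refl dvd_trans)
    ultimately have "int p dvd b x" if "x \<in> carrier G" for x
      using prime_dvd_convolution_square[OF fin p(1)] that by blast
    then have "int (g * p) dvd a x" if "x \<in> carrier G" for x
      using that by (simp add: ab)
    then have "g * p \<le> g" using mx[of "g * p"] e p(2) by auto
    then show False using \<open>g > 0\<close> prime_gt_1_nat[OF p(1)] by simp
  qed
  moreover define Q where "Q g \<longleftrightarrow> g dvd d \<and> (\<forall>x\<in>carrier G. int g dvd a x)" for g
  have "Q 1" by (simp add: Q_def)
  then obtain g where "Q g" "\<And>g'. Q g' \<Longrightarrow> g' \<le> g"
    using Greatest_le_nat[of Q _ d] GreatestI_nat[of Q 1 d] d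
    by (metis Q_def dvd_imp_le)
  ultimately show ?thesis using x unfolding Q_def by metis
qed

end

section \<open>The power map onto a factor of coprime order\<close>

context comm_group
begin

text \<open>
  Cauchy's theorem: an element of order \<open>p\<close> exists, and its order divides every exponent of the group.
\<close>

lemma prime_dvd_exponent:
  assumes fin: "finite (carrier G)" and exp: "\<And>x. x \<in> carrier G \<Longrightarrow> x [^] q = \<one>"
    and p: "prime p" "p dvd order G"
  shows "p dvd (q :: nat)"
proof -
  obtain j where "order G = p ^ 1 * j" using p(2) by auto
  then obtain P where P: "subgroup P G" "card P = p"
    using sylow_thm[OF p(1) is_group _ fin, of 1 j] by auto
  have "P \<noteq> {\<one>}" using P(2) p(1) by auto
  then obtain x where x: "x \<in> P" "x \<noteq> \<one>"
    using P(1) subgroup.one_closed by blast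
  have xG: "x \<in> carrier G" using x(1) P(1) by (rule subgroup.mem_carrier[rotated])
  have "group (G\<lparr>carrier := P\<rparr>)" using P(1) is_group by (rule subgroup.subgroup_is_group)
  then have "x [^]\<^bsub>G\<lparr>carrier := P\<rparr>\<^esub> p = \<one>"
    using group.pow_order_eq_1[of "G\<lparr>carrier := P\<rparr>" x] x(1) P(2) by (simp add: order_def)
  then have "x [^] p = \<one>" by (simp add: nat_pow_consistent[symmetric])
  then have "ord x dvd p" using xG by (simp add: pow_eq_id)
  moreover have "ord x \<noteq> 1" using ord_eq_1[OF xG] x(2) by simp
  ultimately have "ord x = p" using p(1) by (auto simp: prime_nat_iff)
  then show ?thesis using exp[OF xG] xG by (simp add: pow_eq_id)
qed

lemma subgroup_comm_group:
  assumes "subgroup I G" shows "comm_group (G\<lparr>carrier := I\<rparr>)"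
proof (rule group.group_comm_groupI)
  show "group (G\<lparr>carrier := I\<rparr>)" using assms is_group by (rule subgroup.subgroup_is_group)
qed (use subgroup.mem_carrier[OF assms] in \<open>simp add: m_comm\<close>)

lemma coprime_order_of_exponent:
  assumes fin: "finite (carrier G)" and I: "subgroup I G" 
    and exp: "\<And>x. x \<in> I \<Longrightarrow> x [^] (q :: nat) = \<one>" and cop: "coprime q w"
  shows "coprime (card I) w"
proof (rule ccontr)
  assume "\<not> coprime (card I) w"
  then have "gcd (card I) w \<noteq> 1" by (simp add: coprime_iff_gcd_eq_1)
  then obtain p where "prime p" "p dvd gcd (card I) w" using prime_factor_nat by blast
  then have p: "prime p" "p dvd card I" "p dvd w" by auto
  have "p dvd q"
    using comm_group.prime_dvd_exponent[OF subgroup_comm_group[OF I], of q p] p I exp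
      finite_subset[OF subgroup.subset[OF I] fin]
    by (simp add: order_def nat_pow_consistent[symmetric])
  then have "p = 1" using cop p(3) coprime_common_divisor_nat by blast
  then show False using p(1) by simp
qed

text \<open>
  The image \<open>I\<close> of the power map has exponent dividing \<open>q\<close> and its kernel \<open>K\<close> has exponent dividing \<open>w\<close>. By
  coprimality \<open>card I\<close> divides \<open>q\<close> and \<open>card K\<close> divides \<open>w\<close>, and both are equalities because the product of the two
  is \<open>q * w\<close>. This realises the quotient of order \<open>q\<close> inside the group, for composite \<open>w\<close> as well.
\<close>

lemma power_image:
  assumes fin: "finite (carrier G)" and ord: "order G = q * w" and cop: "coprime q w"
  defines "I \<equiv> (\<lambda>x. x [^] w) ` carrier G"
  shows power_image_subgroup: "subgroup I G"
    and card_power_image: "card I = q"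
    and card_power_fibre: "\<And>y. y \<in> I \<Longrightarrow> card {x \<in> carrier G. x [^] w = y} = w"
proof -
  define K where "K = {x \<in> carrier G. x [^] w = \<one>}"
  show I: "subgroup I G"
  proof
    show "I \<subseteq> carrier G" "\<one> \<in> I" by (auto simp: I_def intro: image_eqI[of _ _ \<one>])
    show "x \<otimes> y \<in> I" if xy: "x \<in> I" "y \<in> I" for x y
    proof -
      obtain x' y' where *: "x = x' [^] w" "y = y' [^] w" "x' \<in> carrier G" "y' \<in> carrier G"
        using xy by (auto simp: I_def)
      then have "x \<otimes> y = (x' \<otimes> y') [^] w" by (simp add: nat_pow_distrib)
      then show ?thesis unfolding I_def using * by blast
    qed
    show "inv x \<in> I" if x: "x \<in> I" for x
    proof -
      obtain x' where *: "x = x' [^] w" "x' \<in> carrier G" using x by (auto simp: I_def)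
      then have "inv x = (inv x') [^] w" by (simp add: nat_pow_inv)
      then show ?thesis unfolding I_def using * by blast
    qed
  qed
  have K: "subgroup K G"
    by standard (auto simp: K_def nat_pow_distrib nat_pow_inv)
  have fibre: "card {x \<in> carrier G. x [^] w = y} = card K" if y: "y \<in> I" for y
  proof -
    obtain z where z: "z \<in> carrier G" "y = z [^] w" using y by (auto simp: I_def)
    have "bij_betw (\<lambda>x. z \<otimes> x) K {x \<in> carrier G. x [^] w = y}"
    proof (rule bij_betw_byWitness[where f' = "\<lambda>x. inv z \<otimes> x"])
      show "\<forall>a\<in>K. inv z \<otimes> (z \<otimes> a) = a"
        "\<forall>a\<in>{x \<in> carrier G. x [^] w = y}. z \<otimes> (inv z \<otimes> a) = a"
        using z(1) by (auto simp: K_def m_assoc[symmetric])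
      show "(\<lambda>x. z \<otimes> x) ` K \<subseteq> {x \<in> carrier G. x [^] w = y}"
        "(\<lambda>x. inv z \<otimes> x) ` {x \<in> carrier G. x [^] w = y} \<subseteq> K"
        using z by (auto simp: K_def nat_pow_distrib nat_pow_inv)
    qed
    then show ?thesis by (metis bij_betw_same_card)
  qed
  have "order G = (\<Sum>y\<in>I. card {x \<in> carrier G. x [^] w = y})"
    using sum.image_gen[OF fin, of "\<lambda>_. 1 :: nat" "\<lambda>x. x [^] w"] by (simp add: order_def I_def)
  then have prod: "card I * card K = q * w" using ord fibre by simp
  have "x [^] q = \<one>" if "x \<in> I" for x
    using that pow_order_eq_1 ord by (auto simp: I_def nat_pow_pow mult.commute)
  then have "coprime (card I) w" by (rule coprime_order_of_exponent[OF fin I _ cop])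
  then have Iq: "card I dvd q" using prod by (metis coprime_dvd_mult_left_iff dvd_triv_left)
  have "coprime (card K) q"
    by (rule coprime_order_of_exponent[OF fin K _ cop[THEN coprime_imp_coprime]]) (auto simp: K_def coprime_commute cop)
  then have Kw: "card K dvd w" using prod by (metis coprime_dvd_mult_right_iff dvd_triv_right)
  have pos: "q > 0" "w > 0" using ord fin order_gt_0_iff_finite by auto
  have le: "card I \<le> q" "card K \<le> w" using Iq Kw pos by (auto dest: dvd_imp_le)
  show "card I = q"
  proof (rule ccontr)
    assume "card I \<noteq> q"
    then have "card I * w < q * w" using le(1) pos(2) by simp
    moreover have "card I * card K \<le> card I * w" using le(2) by (rule mult_le_mono2)
    ultimately show False using prod by linarith
  qed
  then have "card K = w" using prod pos by simp
  then show "card {x \<in> carrier G. x [^] w = y} = w" if "y \<in> I" for y using fibre that by simp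
qed

end

section \<open>Partial difference sets in abelian groups\<close>

lemma diff_reps_eq_sum:
  assumes "finite D"
  shows "int (diff_reps G D x) =
    (\<Sum>g\<in>D. \<Sum>h\<in>D. of_bool (g \<noteq> h \<and> g \<otimes>\<^bsub>G\<^esub> inv\<^bsub>G\<^esub> h = x))"
proof -
  have "{(g, h). g \<in> D \<and> h \<in> D \<and> g \<noteq> h \<and> g \<otimes>\<^bsub>G\<^esub> inv\<^bsub>G\<^esub> h = x}
      = {p \<in> D \<times> D. fst p \<noteq> snd p \<and> fst p \<otimes>\<^bsub>G\<^esub> inv\<^bsub>G\<^esub> (snd p) = x}" by auto
  then have "int (diff_reps G D x) =
      (\<Sum>p\<in>D \<times> D. of_bool (fst p \<noteq> snd p \<and> fst p \<otimes>\<^bsub>G\<^esub> inv\<^bsub>G\<^esub> (snd p) = x))"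
    using assms by (simp add: diff_reps_def sum_of_bool_eq Int_def)
  then show ?thesis by (simp add: sum.cartesian_product split_def)
qed

context comm_group
begin

lemma div_eq_one_iff:
  assumes "g \<in> carrier G" "h \<in> carrier G"
  shows "g \<otimes> inv h = \<one> \<longleftrightarrow> g = h"
  using inv_solve_right'[of \<one> g h] assms by simp

text \<open>
  Exchanging the two elements of a pair inverts their quotient, so \<open>x\<close> and its inverse have equally
  many representations; for \<open>l \<noteq> u\<close> that number tells whether an element lies in \<open>D\<close>.
\<close>

lemma pds_inv_closed:
  assumes D: "partial_difference_set G D v k l u" and lu: "l \<noteq> u" and x: "x \<in> D"
  shows "inv x \<in> D"
proof (cases "x = \<one>")
  case True then show ?thesis using x by simp
next
  case False
  have sub: "D \<subseteq> carrier G" and fin: "finite D"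
    using D by (auto simp: partial_difference_set_def intro: finite_subset)
  have xG: "x \<in> carrier G" using x sub by auto
  have *: "g \<otimes> inv h = inv x \<longleftrightarrow> h \<otimes> inv g = x" if "g \<in> D" "h \<in> D" for g h
  proof -
    have "inv (g \<otimes> inv h) = h \<otimes> inv g" using subsetD[OF sub that(1)] subsetD[OF sub that(2)] by (simp add: inv_mult_group)
    moreover have "g \<otimes> inv h \<in> carrier G" using subsetD[OF sub that(1)] subsetD[OF sub that(2)] by simp
    ultimately show ?thesis using xG by (metis inv_inv)
  qed
  have "int (diff_reps G D (inv x)) = (\<Sum>g\<in>D. \<Sum>h\<in>D. of_bool (h \<noteq> g \<and> h \<otimes> inv g = x))"
    unfolding diff_reps_eq_sum[OF fin] by (intro sum.cong refl) (auto simp: *)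
  also have "\<dots> = int (diff_reps G D x)"
    unfolding diff_reps_eq_sum[OF fin] by (rule sum.swap)
  finally have "int (diff_reps G D (inv x)) = int (diff_reps G D x)" .
  moreover have "int (diff_reps G D x) = l"
    using D x False by (auto simp: partial_difference_set_def)
  moreover have "int (diff_reps G D (inv x)) = u" if "inv x \<notin> D"
    using D that False xG by (auto simp: partial_difference_set_def)
  ultimately show ?thesis using lu by auto
qed

text \<open>
  Double counting of the ordered pairs of distinct elements of \<open>D\<close>. The count depends on whether
  \<open>\<one>\<close> lies in \<open>D\<close>, which is how the parameters exclude \<open>\<one> \<in> D\<close> in the end.
\<close>

lemma pds_count:
  assumes D: "partial_difference_set G D v k l u"
  shows "k * (k - 1) = l * int (card (D - {\<one>})) + u * (v - 1 - int (card (D - {\<one>})))"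
proof -
  have sub: "D \<subseteq> carrier G" and fin: "finite D" and finG: "finite (carrier G)"
    using D by (auto simp: partial_difference_set_def intro: finite_subset)
  let ?C = "carrier G - {\<one>}"
  have "(\<Sum>z\<in>?C. int (diff_reps G D z)) = (\<Sum>g\<in>D. \<Sum>h\<in>D. \<Sum>z\<in>?C. of_bool (g \<noteq> h \<and> g \<otimes> inv h = z))"
    unfolding diff_reps_eq_sum[OF fin]
    by (subst sum.swap, rule sum.cong[OF refl], rule sum.swap)
  also have "\<dots> = (\<Sum>g\<in>D. \<Sum>h\<in>D. of_bool (g \<noteq> h))"
  proof (intro sum.cong refl)
    fix g h assume gh: "g \<in> D" "h \<in> D"
    show "(\<Sum>z\<in>?C. of_bool (g \<noteq> h \<and> g \<otimes> inv h = z)) = (of_bool (g \<noteq> h) :: int)"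
    proof (cases "g = h")
      case False
      then have "g \<otimes> inv h \<in> ?C" using gh sub div_eq_one_iff by auto
      then have "?C \<inter> {z. g \<otimes> inv h = z} = {g \<otimes> inv h}" by auto
      then show ?thesis using False finG by (simp add: sum_of_bool_eq)
    qed simp
  qed
  also have "\<dots> = (\<Sum>g\<in>D. int (card D) - 1)"
  proof (intro sum.cong refl)
    fix g assume g: "g \<in> D"
    then have "D \<inter> {h. g \<noteq> h} = D - {g}" by auto
    moreover have "card D \<ge> 1" using g fin by (metis One_nat_def Suc_leI card_gt_0_iff empty_iff)
    ultimately show "(\<Sum>h\<in>D. of_bool (g \<noteq> h)) = int (card D) - 1"
      using g fin by (simp add: sum_of_bool_eq card_Diff_singleton of_nat_diff)
  qed
  also have "\<dots> = k * (k - 1)" using D by (simp add: partial_difference_set_def)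
  finally have total: "(\<Sum>z\<in>?C. int (diff_reps G D z)) = k * (k - 1)" .
  have C: "?C = (D - {\<one>}) \<union> (carrier G - D - {\<one>})" using sub by auto
  have "(\<Sum>z\<in>?C. int (diff_reps G D z)) =
      (\<Sum>z\<in>D - {\<one>}. int (diff_reps G D z)) + (\<Sum>z\<in>carrier G - D - {\<one>}. int (diff_reps G D z))"
    unfolding C by (rule sum.union_disjoint) (use fin finG in auto)
  also have "\<dots> = (\<Sum>z\<in>D - {\<one>}. l) + (\<Sum>z\<in>carrier G - D - {\<one>}. u)"
    using D by (intro arg_cong2[where f = "(+)"] sum.cong refl) (auto simp: partial_difference_set_def)
  also have "\<dots> = l * int (card (D - {\<one>})) + u * int (card (carrier G - D - {\<one>}))" by simp
  also have "int (card (carrier G - D - {\<one>})) = v - 1 - int (card (D - {\<one>}))"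
  proof -
    have "card ?C = card (D - {\<one>}) + card (carrier G - D - {\<one>})"
      unfolding C by (rule card_Un_disjoint) (use fin finG in auto)
    moreover have "card (carrier G) = Suc (card ?C)"
      using finG by (simp add: card_Suc_Diff1 del: card_Diff_insert)
    moreover have "int (card (carrier G)) = v"
      using D unfolding partial_difference_set_def order_def by blast
    ultimately show ?thesis by linarith
  qed
  finally show ?thesis unfolding total .
qed

text \<open>
  The equation \<open>D\<^sup>2 = (k - u) \<one> + (l - u) D + u G\<close> in the group ring. By symmetry of \<open>D\<close>
  products and quotients of its elements have the same distribution.
\<close>

lemma pds_products:
  assumes D: "partial_difference_set G D v k l u" and lu: "l \<noteq> u" and one: "\<one> \<notin> D"
    and z: "z \<in> carrier G"
  shows "(\<Sum>g\<in>D. \<Sum>h\<in>D. of_bool (g \<otimes> h = z)) =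
    (k - u) * of_bool (z = \<one>) + (l - u) * of_bool (z \<in> D) + u"
proof -
  have sub: "D \<subseteq> carrier G" and fin: "finite D"
    using D by (auto simp: partial_difference_set_def intro: finite_subset)
  note inv = pds_inv_closed[OF D lu]
  have "(\<Sum>h\<in>D. of_bool (g \<otimes> h = z)) = (\<Sum>h\<in>D. of_bool (g \<otimes> inv h = z) :: int)" for g
    by (rule sum.reindex_bij_witness[where i = "\<lambda>h. inv h" and j = "\<lambda>h. inv h"])
       (use inv sub in \<open>auto simp: subsetD\<close>)
  then have eq: "(\<Sum>g\<in>D. \<Sum>h\<in>D. of_bool (g \<otimes> h = z)) = (\<Sum>g\<in>D. \<Sum>h\<in>D. of_bool (g \<otimes> inv h = z) :: int)"
    by simp
  show ?thesis
  proof (cases "z = \<one>")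
    case True
    have "(\<Sum>h\<in>D. of_bool (g \<otimes> inv h = z)) = (1 :: int)" if "g \<in> D" for g
    proof -
      have "D \<inter> {h. g \<otimes> inv h = z} = {g}"
        using that sub div_eq_one_iff True by auto
      then show ?thesis using fin by (simp add: sum_of_bool_eq)
    qed
    then have "(\<Sum>g\<in>D. \<Sum>h\<in>D. of_bool (g \<otimes> inv h = z)) = int (card D)" by simp
    then show ?thesis unfolding eq using D True one by (simp add: partial_difference_set_def)
  next
    case False
    have "(\<Sum>g\<in>D. \<Sum>h\<in>D. of_bool (g \<otimes> inv h = z)) = int (diff_reps G D z)"
      unfolding diff_reps_eq_sum[OF fin] using False sub
      by (intro sum.cong refl) (auto simp: subsetD)
    then show ?thesis using D False z by (auto simp: eq partial_difference_set_def)
  qed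
qed

end

section \<open>The projection of a partial difference set\<close>

context comm_group
begin

definition power_fibre_count :: "nat \<Rightarrow> 'a set \<Rightarrow> 'a \<Rightarrow> int" where
  "power_fibre_count w D y = (\<Sum>g\<in>D. of_bool (g [^] w = y))"

text \<open>
  The image of the group ring element \<open>D - r \<one>\<close> under the power map. For an eigenvalue \<open>r\<close> of \<open>D\<close>
  the shift removes the multiple of \<open>\<one>\<close> from the quadratic equation of \<open>D\<close>.
\<close>

definition shifted_projection :: "nat \<Rightarrow> 'a set \<Rightarrow> int \<Rightarrow> 'a \<Rightarrow> int" where
  "shifted_projection w D r y = power_fibre_count w D y - r * of_bool (y = \<one>)"

text \<open>
  The equation for \<open>D\<^sup>2\<close> is summed over a fibre \<open>Y\<close> of the power map: the term \<open>u G\<close> contributes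
  \<open>u\<close> for each of the \<open>w\<close> elements of \<open>Y\<close>.
\<close>

lemma power_fibre_count_convolution:
  assumes D: "partial_difference_set G D v k l u" and lu: "l \<noteq> u" and one: "\<one> \<notin> D"
    and ord: "order G = q * w" and cop: "coprime q w"
    and y: "y \<in> (\<lambda>x. x [^] w) ` carrier G"
  shows "(\<Sum>x\<in>(\<lambda>x. x [^] w) ` carrier G. power_fibre_count w D x * power_fibre_count w D (inv x \<otimes> y)) =
    (k - u) * of_bool (y = \<one>) + (l - u) * power_fibre_count w D y + u * int w"
    (is "(\<Sum>x\<in>?I. _) = _")
proof -
  have sub: "D \<subseteq> carrier G" and fin: "finite D" and finG: "finite (carrier G)"
    using D by (auto simp: partial_difference_set_def intro: finite_subset)
  have yG: "y \<in> carrier G" using y by auto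
  define Y where "Y = {z \<in> carrier G. z [^] w = y}"
  have Y: "Y \<subseteq> carrier G" "finite Y" using finG by (auto simp: Y_def)
  have cardY: "card Y = w" using card_power_fibre[OF finG ord cop y] by (simp add: Y_def)
  have "(\<Sum>x\<in>?I. power_fibre_count w D x * power_fibre_count w D (inv x \<otimes> y))
      = (\<Sum>x\<in>?I. \<Sum>g\<in>D. \<Sum>h\<in>D. of_bool (g [^] w = x) * of_bool (h [^] w = inv x \<otimes> y))"
    by (simp add: power_fibre_count_def sum_product)
  also have "\<dots> = (\<Sum>g\<in>D. \<Sum>h\<in>D. \<Sum>x\<in>?I. of_bool (g [^] w = x) * of_bool (h [^] w = inv x \<otimes> y))"
    by (subst sum.swap, rule sum.cong[OF refl], rule sum.swap)
  also have "\<dots> = (\<Sum>g\<in>D. \<Sum>h\<in>D. \<Sum>z\<in>Y. of_bool (g \<otimes> h = z))"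
  proof (rule sum.cong[OF refl], rule sum.cong[OF refl])
    fix g h assume "g \<in> D" "h \<in> D"
    then have gh: "g \<in> carrier G" "h \<in> carrier G" using sub by auto
    have "(\<Sum>x\<in>?I. of_bool (g [^] w = x) * of_bool (h [^] w = inv x \<otimes> y)) =
        (\<Sum>x\<in>?I. if x = g [^] w then of_bool (h [^] w = inv (g [^] w) \<otimes> y) else (0 :: int))"
      by (intro sum.cong refl) auto
    also have "\<dots> = of_bool (h [^] w = inv (g [^] w) \<otimes> y)"
      using gh finG by simp
    also have "\<dots> = of_bool ((g \<otimes> h) [^] w = y)"
      using inv_solve_left[of "h [^] w" "g [^] w" y] gh yG by (auto simp: nat_pow_distrib)
    also have "\<dots> = (\<Sum>z\<in>Y. if z = g \<otimes> h then 1 else (0 :: int))"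
      using gh Y(2) by (simp add: Y_def)
    also have "\<dots> = (\<Sum>z\<in>Y. of_bool (g \<otimes> h = z))"
      by (intro sum.cong refl) auto
    finally show "(\<Sum>x\<in>?I. of_bool (g [^] w = x) * of_bool (h [^] w = inv x \<otimes> y)) =
      (\<Sum>z\<in>Y. of_bool (g \<otimes> h = z) :: int)" .
  qed
  also have "\<dots> = (\<Sum>z\<in>Y. \<Sum>g\<in>D. \<Sum>h\<in>D. of_bool (g \<otimes> h = z))"
    by (subst (2) sum.swap, rule sum.cong[OF refl], rule sum.swap)
  also have "\<dots> = (\<Sum>z\<in>Y. (k - u) * of_bool (z = \<one>) + (l - u) * of_bool (z \<in> D) + u)"
    by (intro sum.cong refl pds_products[OF D lu one]) (use Y in auto)
  also have "\<dots> = (k - u) * (\<Sum>z\<in>Y. of_bool (z = \<one>)) + (l - u) * (\<Sum>z\<in>Y. of_bool (z \<in> D)) + u * int w"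
    by (simp add: sum.distrib sum_distrib_left cardY)
  also have "(\<Sum>z\<in>Y. of_bool (z = \<one>)) = (of_bool (y = \<one>) :: int)"
  proof -
    have "Y \<inter> {z. z = \<one>} = (if y = \<one> then {\<one>} else {})" by (auto simp: Y_def)
    then show ?thesis using Y(2) by (simp add: sum_of_bool_eq)
  qed
  also have "(\<Sum>z\<in>Y. of_bool (z \<in> D)) = power_fibre_count w D y"
  proof -
    have "Y \<inter> {z. z \<in> D} = D \<inter> {g. g [^] w = y}" using sub by (auto simp: Y_def)
    then show ?thesis using Y(2) fin by (simp add: sum_of_bool_eq power_fibre_count_def)
  qed
  finally show ?thesis .
qed

text \<open>
  Here \<open>r\<close> is a root of the quadratic polynomial of \<open>D\<close> and \<open>l - u - r\<close> is the other one, so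
  the factor on the right is the difference of the two eigenvalues.
\<close>

lemma shifted_projection_convolution:
  assumes D: "partial_difference_set G D v k l u" and lu: "l \<noteq> u" and one: "\<one> \<notin> D"
    and ord: "order G = q * w" and cop: "coprime q w"
    and root: "r\<^sup>2 = (l - u) * r + (k - u)"
    and y: "y \<in> (\<lambda>x. x [^] w) ` carrier G"
  shows "(\<Sum>x\<in>(\<lambda>x. x [^] w) ` carrier G. shifted_projection w D r x * shifted_projection w D r (inv x \<otimes> y)) =
    (l - u - 2 * r) * shifted_projection w D r y + u * int w"
    (is "(\<Sum>x\<in>?I. _) = _")
proof -
  let ?b = "power_fibre_count w D"
  have finG: "finite (carrier G)" using D by (simp add: partial_difference_set_def)
  have yG: "y \<in> carrier G" using y by auto
  have I1: "\<one> \<in> ?I" by (rule image_eqI[of _ _ \<one>]) auto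
  have inv_eq: "inv x \<otimes> y = \<one> \<longleftrightarrow> x = y" if "x \<in> ?I" for x
    using inv_solve_left'[of \<one> x y] that yG by auto
  have "(\<Sum>x\<in>?I. shifted_projection w D r x * shifted_projection w D r (inv x \<otimes> y)) =
      (\<Sum>x\<in>?I. ?b x * ?b (inv x \<otimes> y) - r * (if x = y then ?b y else 0)
        - r * (if x = \<one> then ?b y else 0) + r\<^sup>2 * (if x = \<one> then of_bool (y = \<one>) else 0))"
    by (intro sum.cong refl)
       (use yG inv_eq in \<open>auto simp: shifted_projection_def algebra_simps power2_eq_square\<close>)
  also have "\<dots> = (\<Sum>x\<in>?I. ?b x * ?b (inv x \<otimes> y)) - r * ?b y - r * ?b y + r\<^sup>2 * of_bool (y = \<one>)"
    using finG y I1 by (simp add: sum.distrib sum_subtractf flip: sum_distrib_left)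
  also have "\<dots> = (l - u - 2 * r) * shifted_projection w D r y + u * int w
      + (k - u - r\<^sup>2 + (l - u) * r) * of_bool (y = \<one>)"
    unfolding power_fibre_count_convolution[OF D lu one ord cop y] shifted_projection_def
    by (simp add: algebra_simps power2_eq_square)
  finally show ?thesis using root by simp
qed

lemma sum_shifted_projection:
  assumes "finite (carrier G)" "D \<subseteq> carrier G"
  shows "(\<Sum>x\<in>(\<lambda>x. x [^] w) ` carrier G. shifted_projection w D r x) = int (card D) - r"
    (is "(\<Sum>x\<in>?I. _) = _")
proof -
  have fin: "finite ?I" using assms by simp
  have I1: "\<one> \<in> ?I" by (rule image_eqI[of _ _ \<one>]) auto
  have "(\<Sum>x\<in>?I. power_fibre_count w D x) = (\<Sum>g\<in>D. \<Sum>x\<in>?I. of_bool (g [^] w = x))"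
    unfolding power_fibre_count_def by (rule sum.swap)
  also have "\<dots> = (\<Sum>g\<in>D. 1)"
  proof (intro sum.cong refl)
    fix g assume "g \<in> D"
    then have "?I \<inter> {x. g [^] w = x} = {g [^] w}" using assms by auto
    then show "(\<Sum>x\<in>?I. of_bool (g [^] w = x)) = (1 :: int)" using fin by (simp add: sum_of_bool_eq)
  qed
  finally have "(\<Sum>x\<in>?I. power_fibre_count w D x) = int (card D)" by simp
  moreover have "?I \<inter> {x. x = \<one>} = {\<one>}" using I1 by auto
  ultimately show ?thesis
    using fin by (simp add: shifted_projection_def sum_subtractf sum_of_bool_eq flip: sum_distrib_left)
qed

lemma shifted_projection_inv:
  assumes D: "partial_difference_set G D v k l u" and lu: "l \<noteq> u" and x: "x \<in> carrier G"
  shows "shifted_projection w D r (inv x) = shifted_projection w D r x"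
proof -
  have sub: "D \<subseteq> carrier G" using D by (simp add: partial_difference_set_def)
  have *: "inv (g [^] w) = x \<longleftrightarrow> g [^] w = inv x" if "g \<in> D" for g
    using that sub x by (metis inv_inv nat_pow_closed subsetD)
  have "power_fibre_count w D (inv x) = power_fibre_count w D x"
    unfolding power_fibre_count_def
    by (rule sum.reindex_bij_witness[where i = "\<lambda>h. inv h" and j = "\<lambda>h. inv h"])
       (use pds_inv_closed[OF D lu] sub x in \<open>auto simp: subsetD nat_pow_inv *\<close>)
  moreover have "inv x = \<one> \<longleftrightarrow> x = \<one>" using x by (simp add: inv_eq_1_iff)
  ultimately show ?thesis by (simp add: shifted_projection_def)
qed

end

section \<open>The contradiction\<close>

text \<open>
  All squares other than the one at \<open>i\<close> are at least \<open>1\<close>. Hence \<open>(z i)\<^sup>2 + 4 t\<^sup>2 - 1 \<le> 4 t (z i)\<close>, that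
  is, \<open>(z i - 2 t)\<^sup>2 \<le> 1\<close>.
\<close>

lemma odd_square_sum_bound:
  fixes z :: "'i \<Rightarrow> int"
  assumes fin: "finite I" and i: "i \<in> I" and odd: "\<And>x. x \<in> I \<Longrightarrow> odd (z x)"
    and card: "int (card I) = (2 * t)\<^sup>2"
    and eq: "(\<Sum>x\<in>I. (z x)\<^sup>2) = 4 * t * z i"
  shows "2 * t - 1 \<le> z i"
proof -
  have "(1 :: int) \<le> (z x)\<^sup>2" if "x \<in> I" for x
  proof -
    have "z x \<noteq> 0" using odd[OF that] by auto
    then show ?thesis by (simp add: int_one_le_iff_zero_less)
  qed
  then have "(\<Sum>x\<in>I - {i}. 1) \<le> (\<Sum>x\<in>I - {i}. (z x)\<^sup>2)" by (intro sum_mono) auto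
  moreover have "(\<Sum>x\<in>I. (z x)\<^sup>2) = (z i)\<^sup>2 + (\<Sum>x\<in>I - {i}. (z x)\<^sup>2)"
    using fin i by (rule sum.remove)
  moreover have "card I = Suc (card (I - {i}))" using fin i by (simp add: card_Suc_Diff1 del: card_Diff_insert)
  ultimately have "(z i)\<^sup>2 + (2 * t)\<^sup>2 - 1 \<le> 4 * t * z i" using card eq by simp
  then have "(z i - 2 * t)\<^sup>2 \<le> 1\<^sup>2" by (simp add: power2_eq_square algebra_simps)
  then have "\<bar>z i - 2 * t\<bar> \<le> 1" by (simp only: abs_le_square_iff[symmetric])
  then show ?thesis by linarith
qed

context comm_group
begin

text \<open>
  With these parameters \<open>r\<close> and \<open>r - m\<close> are the roots of the quadratic polynomial of \<open>D\<close>. Evenness of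
  \<open>t\<close> makes \<open>s\<close> odd, which serves twice: the factors of the group order are coprime, and the numbers \<open>s - 2 c\<close>
  are odd.
\<close>

lemma no_pds_even_parameter:
  fixes t :: nat
  assumes t: "even t" "t > 0"
  defines "s \<equiv> t + 1"
  assumes fin: "finite (carrier G)" and ord: "order G = 64 * t\<^sup>2 * s ^ 4"
    and D: "partial_difference_set G D v k l u"
    and one: "\<one> \<notin> D"
    and k: "k = r * (m + 1)" and l: "l = - m + r\<^sup>2 + 3 * r" and u: "u = r\<^sup>2 + r"
    and m: "m = 8 * int t * (int s)\<^sup>2" and r: "r = 4 * int t * int s"
  shows False
proof -
  let ?w = "s ^ 4" and ?t = "int t" and ?s = "int s"
  let ?I = "(\<lambda>x. x [^] ?w) ` carrier G"
  define a where "a = shifted_projection ?w D r"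
  have sub: "D \<subseteq> carrier G" and cardD: "int (card D) = k"
    using D unfolding partial_difference_set_def by blast+
  have s_pos: "?s > 0" by (simp add: s_def)
  have cop: "coprime (64 * t\<^sup>2) ?w"
  proof -
    have "coprime t s" by (simp add: s_def)
    moreover have "coprime 2 s" using t by (simp add: s_def)
    ultimately have "coprime (2 ^ 6 * t\<^sup>2) ?w"
      by (simp only: coprime_mult_left_iff coprime_power_left_iff coprime_power_right_iff simp_thms)
    then show ?thesis by simp
  qed
  have lu_diff: "l - u = 2 * r - m" by (simp add: l u)
  have "2 * r - m = - 8 * ?t\<^sup>2 * ?s"
    by (simp add: m r s_def power2_eq_square algebra_simps)
  then have lu: "l \<noteq> u" using lu_diff t(2) s_pos by auto
  have root: "r\<^sup>2 = (l - u) * r + (k - u)"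
    unfolding lu_diff by (simp add: k u power2_eq_square algebra_simps)
  have conv: "(\<Sum>x\<in>?I. a x * a (inv x \<otimes> y)) = - m * a y + u * int ?w" if "y \<in> ?I" for y
    using shifted_projection_convolution[OF D lu one ord cop root that] lu_diff by (simp add: a_def)
  have I: "subgroup ?I G" by (rule power_image_subgroup[OF fin ord cop])
  have cardI: "card ?I = 64 * t\<^sup>2" by (rule card_power_image[OF fin ord cop])
  have finI: "finite ?I" using fin by simp
  have I1: "\<one> \<in> ?I" by (rule subgroup.one_closed[OF I])
  have a_dvd: "?s\<^sup>2 dvd a x" if x: "x \<in> ?I" for x
  proof -
    interpret H: comm_group "G\<lparr>carrier := ?I\<rparr>" by (rule subgroup_comm_group[OF I])
    have "int (s\<^sup>2) dvd a x"
    proof (rule H.dvd_of_convolution_eq)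
      show "coprime (s\<^sup>2) (order (G\<lparr>carrier := ?I\<rparr>))"
        using cop cardI by (simp add: order_def coprime_commute)
      show "(\<Sum>x\<in>carrier (G\<lparr>carrier := ?I\<rparr>). a x *
          a (inv\<^bsub>G\<lparr>carrier := ?I\<rparr>\<^esub> x \<otimes>\<^bsub>G\<lparr>carrier := ?I\<rparr>\<^esub> y)) = - m * a y + u * int ?w"
        if "y \<in> carrier (G\<lparr>carrier := ?I\<rparr>)" for y
      proof -
        have "(\<Sum>x\<in>?I. a x * a (inv\<^bsub>G\<lparr>carrier := ?I\<rparr>\<^esub> x \<otimes> y)) = (\<Sum>x\<in>?I. a x * a (inv x \<otimes> y))"
          by (intro sum.cong refl) (simp add: m_inv_consistent[OF I])
        then show ?thesis using conv that by simp
      qed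
      show "int (s\<^sup>2) dvd - m" by (simp add: m)
      show "(int (s\<^sup>2))\<^sup>2 dvd u * int ?w" by (simp add: power_mult[symmetric])
    qed (use finI x s_pos in auto)
    then show ?thesis by simp
  qed
  \<comment> \<open>twice the mean of \<open>c\<close> over the \<open>64 t\<^sup>2\<close> elements is \<open>s\<close>, so \<open>s - 2 c\<close> below is centred at zero\<close>
  define c where "c x = a x div ?s\<^sup>2" for x
  have ac: "a x = ?s\<^sup>2 * c x" if "x \<in> ?I" for x using a_dvd[OF that] by (simp add: c_def)
  have "?s\<^sup>2 * (\<Sum>x\<in>?I. c x) = (\<Sum>x\<in>?I. a x)"
    by (simp add: sum_distrib_left ac)
  also have "\<dots> = ?s\<^sup>2 * (8 * ?t * r)"
    using sum_shifted_projection[OF fin sub, of ?w r] by (simp add: cardD k m algebra_simps a_def)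
  finally have sum_c: "(\<Sum>x\<in>?I. c x) = 8 * ?t * r" using s_pos by simp
  have "?s ^ 4 * (\<Sum>x\<in>?I. (c x)\<^sup>2) = (\<Sum>x\<in>?I. a x * a (inv x \<otimes> \<one>))"
    unfolding sum_distrib_left
  proof (intro sum.cong refl)
    fix x assume x: "x \<in> ?I"
    then have xG: "x \<in> carrier G" using subgroup.mem_carrier[OF I] by blast
    then have "a (inv x \<otimes> \<one>) = a x" using shifted_projection_inv[OF D lu xG] by (simp add: a_def xG)
    then show "?s ^ 4 * (c x)\<^sup>2 = a x * a (inv x \<otimes> \<one>)"
      by (simp add: ac[OF x] power2_eq_square power4_eq_xxxx)
  qed
  also have "\<dots> = ?s ^ 4 * (u - 8 * ?t * c \<one>)"
    unfolding conv[OF I1] ac[OF I1] by (simp add: m power2_eq_square power4_eq_xxxx algebra_simps)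
  finally have sum_c2: "(\<Sum>x\<in>?I. (c x)\<^sup>2) = u - 8 * ?t * c \<one>" using s_pos by simp
  have "(\<Sum>x\<in>?I. (?s - 2 * c x)\<^sup>2) = (\<Sum>x\<in>?I. ?s\<^sup>2 - 4 * ?s * c x + 4 * (c x)\<^sup>2)"
    by (intro sum.cong refl) (simp add: power2_eq_square algebra_simps)
  also have "\<dots> = 64 * ?t\<^sup>2 * ?s\<^sup>2 - 4 * ?s * (8 * ?t * r) + 4 * (u - 8 * ?t * c \<one>)"
    by (simp add: sum.distrib sum_subtractf cardI sum_c sum_c2 flip: sum_distrib_left)
  also have "\<dots> = 4 * (4 * ?t) * (?s - 2 * c \<one>)"
    by (simp add: u r power2_eq_square algebra_simps)
  finally have squares: "(\<Sum>x\<in>?I. (?s - 2 * c x)\<^sup>2) = 4 * (4 * ?t) * (?s - 2 * c \<one>)" .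
  have "2 * (4 * ?t) - 1 \<le> ?s - 2 * c \<one>"
  proof (rule odd_square_sum_bound[OF finI I1 _ _ squares])
    show "odd (?s - 2 * c x)" for x using t by (simp add: s_def)
    show "int (card ?I) = (2 * (4 * ?t))\<^sup>2" by (simp add: cardI power2_eq_square)
  qed
  then have c_le: "2 * c \<one> \<le> 2 - 7 * ?t" by (simp add: s_def)
  \<comment> \<open>the coefficient of \<open>D\<close> at \<open>\<one>\<close>, namely \<open>s\<^sup>2 c\<^sub>1 + r\<close>, is a cardinality\<close>
  have "0 \<le> power_fibre_count ?w D \<one>" by (simp add: power_fibre_count_def sum_nonneg)
  then have "0 \<le> ?s\<^sup>2 * c \<one> + r" using ac[OF I1] by (simp add: a_def shifted_projection_def)
  then have "0 \<le> ?s * (?s * c \<one> + 4 * ?t)" by (simp add: r power2_eq_square algebra_simps)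
  then have "0 \<le> ?s * c \<one> + 4 * ?t" using s_pos by (simp add: zero_le_mult_iff)
  moreover have "?s * (2 * c \<one>) \<le> ?s * (2 - 7 * ?t)" using c_le s_pos by (intro mult_left_mono) auto
  ultimately have "0 \<le> ?s * (2 - 7 * ?t) + 8 * ?t" by simp
  then have "7 * (?t * ?t) \<le> 3 * ?t + 2" by (simp add: s_def algebra_simps)
  moreover have "2 \<le> ?t" using t by (auto elim: evenE)
  then have "2 * ?t \<le> ?t * ?t" by (intro mult_right_mono) auto
  ultimately show False using \<open>2 \<le> ?t\<close> by linarith
qed

end

theorem theorem5p1:
  fixes G :: "('a, 'b) monoid_scheme" and n :: nat and \<alpha> m r :: int
  assumes "n \<ge> 2"
    and "\<alpha> = 2 ^ n + 1"
    and "m = (\<alpha> + 1)^2 * (\<alpha> - 1)"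
    and "r = \<alpha>^2 - 1"
    and "comm_group G"
  shows "\<not> (\<exists>D. partial_difference_set G D
               (m^2) (r * (m + 1)) (- m + r^2 + 3 * r) (r^2 + r))"
proof
  interpret comm_group G by (rule assms(5))
  assume "\<exists>D. partial_difference_set G D (m^2) (r * (m + 1)) (- m + r^2 + 3 * r) (r^2 + r)"
  then obtain D where D: "partial_difference_set G D (m^2) (r * (m + 1)) (- m + r^2 + 3 * r) (r^2 + r)" ..
  define t :: nat where "t = 2 ^ (n - 1)"
  have "(2 :: int) ^ n = 2 * 2 ^ (n - 1)" using assms(1) by (cases n) auto
  then have \<alpha>: "\<alpha> = 2 * int t + 1" using assms(2) by (simp add: t_def)
  have t: "even t" "t > 0" using assms(1) by (auto simp: t_def)
  have m: "m = 8 * int t * (int (t + 1))\<^sup>2"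
    unfolding assms(3) \<alpha> by (simp add: power2_eq_square algebra_simps)
  have r: "r = 4 * int t * int (t + 1)"
    unfolding assms(4) \<alpha> by (simp add: power2_eq_square algebra_simps)
  have fin: "finite (carrier G)" and sub: "D \<subseteq> carrier G" and cardD: "int (card D) = r * (m + 1)"
    and "int (order G) = m\<^sup>2"
    using D unfolding partial_difference_set_def by blast+
  then have "int (order G) = int (64 * t\<^sup>2 * (t + 1) ^ 4)"
    by (simp add: m power_mult_distrib flip: power_mult)
  then have ord: "order G = 64 * t\<^sup>2 * (t + 1) ^ 4" by (simp only: of_nat_eq_iff)
  have "\<one>\<^bsub>G\<^esub> \<notin> D"
  proof
    assume "\<one>\<^bsub>G\<^esub> \<in> D"
    then have card: "int (card (D - {\<one>\<^bsub>G\<^esub>})) = r * (m + 1) - 1"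
      using cardD finite_subset[OF sub fin]
      by (metis card_Suc_Diff1 of_nat_Suc add_diff_cancel_left')
    \<comment> \<open>the parameters satisfy the count for \<open>\<one> \<notin> D\<close>; the two counts differ by \<open>l - u = 2 * r - m\<close>\<close>
    have "m = 2 * r"
      using pds_count[OF D] unfolding card by (simp add: power2_eq_square algebra_simps)
    then show False using t by (simp add: m r power2_eq_square)
  qed
  then show False
    using no_pds_even_parameter[OF t fin ord D] m r by blast
qed

end
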